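(* Let $G$ be a finite non-nilpotent group. If $U$ is a nilpotent subgroup of $G$ such that $U\nsubseteq \mathrm{nil}(G)$, then $U-(U\cap \mathrm{nil}(G))$ is the set of vertices of a clique of $\Gamma_{\mathfrak N}(G)$. Moreover, if $N$ is a normal nilpotent subgroup of $G$, then $|N-(N\cap \mathrm{nil}(G))|\leq \omega(\Gamma_{\mathfrak N}(G))$. In particular, $|\mathrm{F}(G)-(\mathrm{F}(G)\cap \mathrm{nil}(G))|\leq \omega(\Gamma_{\mathfrak N}(G))$.
   Context: For a finite group $G$, $\mathrm{nil}(G)=\{g\in G:\langle g,h\rangle \text{ is nilpotent for all } h\in G\}$. For a finite non-nilpotent group $G$, the nilpotent graph $\Gamma_{\mathfrak N}(G)$ is the simple undirected graph with vertex set $G-\mathrm{nil}(G)$ (set difference) in which two distinct vertices $g,h$ are adjacent if and only if $\langle g,h\rangle$ is nilpotent. A clique is a complete subgraph, and $\omega(\Gamma)$ is the clique number, i.e. the number of vertices of a largest clique of $\Gamma$. $\mathrm{F}(G)$ is the Fitting subgroup of $G$ (the largest normal nilpotent subgroup). *)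

theory Defs
  imports "HOL-Algebra.Algebra" "HOL-Library.Ramsey"
begin

subsection \<open>Nilpotent groups\<close>

text \<open>As in \<^const>\<open>derived\<close>, the commutator of \<open>x\<close> and \<open>y\<close> is \<open>x y x\<inverse> y\<inverse>\<close>.\<close>

definition commutator_subgroup :: "('a, 'b) monoid_scheme \<Rightarrow> 'a set \<Rightarrow> 'a set \<Rightarrow> 'a set" where
  "commutator_subgroup G H K =
     generate G (\<Union>h\<in>H. \<Union>k\<in>K. { h \<otimes>\<^bsub>G\<^esub> k \<otimes>\<^bsub>G\<^esub> inv\<^bsub>G\<^esub> h \<otimes>\<^bsub>G\<^esub> inv\<^bsub>G\<^esub> k })"

primrec lower_central_series :: "('a, 'b) monoid_scheme \<Rightarrow> nat \<Rightarrow> 'a set" where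
  "lower_central_series G 0 = carrier G"
| "lower_central_series G (Suc n) = commutator_subgroup G (lower_central_series G n) (carrier G)"

definition nilpotent_group :: "('a, 'b) monoid_scheme \<Rightarrow> bool" where
  "nilpotent_group G \<longleftrightarrow> group G \<and> (\<exists>n. lower_central_series G n = {\<one>\<^bsub>G\<^esub>})"

definition nilpotent_subgroup :: "'a set \<Rightarrow> ('a, 'b) monoid_scheme \<Rightarrow> bool" where
  "nilpotent_subgroup H G \<longleftrightarrow> subgroup H G \<and> nilpotent_group (G\<lparr>carrier := H\<rparr>)"

text \<open>\<^const>\<open>Greatest\<close> is taken with respect to inclusion: it denotes the normal nilpotent
  subgroup that contains all others, which exists in every finite group by Fitting's theorem.\<close>

definition fitting_subgroup :: "('a, 'b) monoid_scheme \<Rightarrow> 'a set" where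
  "fitting_subgroup G = (GREATEST N. N \<lhd> G \<and> nilpotent_subgroup N G)"

definition nil_set :: "('a, 'b) monoid_scheme \<Rightarrow> 'a set" where
  "nil_set G =
     {g \<in> carrier G. \<forall>h \<in> carrier G. nilpotent_subgroup (generate G {g, h}) G}"

subsection \<open>Simple undirected graphs and the nilpotent graph\<close>

text \<open>A graph is a pair of its vertex set and its edge set; edges are two-element sets of vertices.\<close>

type_synonym 'a ugraph = "'a set \<times> 'a set set"

text \<open>A clique is identified with its vertex set, which determines it. The library's
  \<^const>\<open>clique\<close> only asks for pairwise adjacency; graphs, hence cliques, are taken to be
  nonempty.\<close>

definition is_clique :: "'a ugraph \<Rightarrow> 'a set \<Rightarrow> bool" where
  "is_clique \<Gamma> C \<longleftrightarrow> C \<noteq> {} \<and> C \<subseteq> fst \<Gamma> \<and> clique C (snd \<Gamma>)"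

text \<open>For finite graphs with at least one vertex.\<close>

definition clique_number :: "'a ugraph \<Rightarrow> nat" where
  "clique_number \<Gamma> = Max {card C | C. is_clique \<Gamma> C}"

definition nilpotent_graph :: "('a, 'b) monoid_scheme \<Rightarrow> 'a ugraph" where
  "nilpotent_graph G =
     (carrier G - nil_set G,
      {{g, h} | g h. g \<in> carrier G - nil_set G \<and> h \<in> carrier G - nil_set G \<and> g \<noteq> h \<and>
                     nilpotent_subgroup (generate G {g, h}) G})"

end

theory Submission
  imports Defs
begin

text \<open>
  The clique claim rests on the fact that nilpotency passes to subgroups: two elements \<open>g\<close>, \<open>h\<close> of
  a nilpotent subgroup \<open>U\<close> generate a subgroup of \<open>U\<close>, which is therefore nilpotent, so
  \<open>g\<close> and \<open>h\<close> are adjacent as soon as they are distinct vertices. The bound by the clique number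
  follows, because the graph is finite; if \<open>N\<close> lies inside \<open>nil(G)\<close>, the bound is
  \<open>0 \<le> \<omega>\<close>.

  The last claim is the case \<open>N = F(G)\<close>, but it requires that the Fitting subgroup exist,
  that is, Fitting's theorem: two normal nilpotent subgroups \<open>H\<close> and \<open>K\<close> generate a
  (normal) nilpotent subgroup. For this, prolong the lower central series of \<open>H\<close> upwards by \<open>G\<close> to
  a chain \<open>A\<^sub>0 = G, A\<^sub>1 = H, A\<^sub>2 = [H, H], \<dots>\<close> of normal subgroups of \<open>G\<close>; commutation with
  \<open>H\<close> moves one step down this chain, while commutation with any element of \<open>G\<close> does not leave a
  term. With the corresponding chain \<open>B\<close> of \<open>K\<close>, the subgroups
  \<open>W\<^sub>n = \<langle>A\<^sub>i \<inter> B\<^sub>j : i + j = n\<rangle>\<close> are such that commutation with \<open>H\<close> or with \<open>K\<close> maps the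
  generators of \<open>W\<^sub>n\<close> into \<open>W\<^sub>n\<^sub>+\<^sub>1\<close>: it raises \<open>i\<close> or \<open>j\<close> by one. Since \<open>W\<^sub>n\<^sub>+\<^sub>1\<close> is normal, the same
  follows for all of \<open>W\<^sub>n\<close> and all of \<open>\<langle>H \<union> K\<rangle>\<close>. For large \<open>n\<close> one index is always so large that the
  intersection is trivial, so \<open>W\<close> is a central chain that witnesses the nilpotency of
  \<open>\<langle>H \<union> K\<rangle>\<close>. In a finite group, a normal nilpotent subgroup of maximal order then contains all
  others.
\<close>

section \<open>Commutators modulo a normal subgroup\<close>

abbreviation commutator :: "('a, 'b) monoid_scheme \<Rightarrow> 'a \<Rightarrow> 'a \<Rightarrow> 'a" where
  "commutator G x y \<equiv> x \<otimes>\<^bsub>G\<^esub> y \<otimes>\<^bsub>G\<^esub> inv\<^bsub>G\<^esub> x \<otimes>\<^bsub>G\<^esub> inv\<^bsub>G\<^esub> y"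

context group
begin

lemma inv_cancel_left:
  assumes "x \<in> carrier G" "z \<in> carrier G"
  shows "inv x \<otimes> (x \<otimes> z) = z" "x \<otimes> (inv x \<otimes> z) = z"
  using assms by (simp_all add: m_assoc[symmetric])

lemma inv_commutator:
  assumes "x \<in> carrier G" "y \<in> carrier G"
  shows "inv (commutator G x y) = commutator G y x"
  using assms by (simp add: inv_mult_group m_assoc)

lemma commutator_mult_left:
  assumes "a \<in> carrier G" "b \<in> carrier G" "x \<in> carrier G"
  shows "commutator G (a \<otimes> b) x = a \<otimes> commutator G b x \<otimes> inv a \<otimes> commutator G a x"
  using assms by (simp add: m_assoc inv_mult_group inv_cancel_left)

lemma commutator_inv_left:
  assumes "a \<in> carrier G" "x \<in> carrier G"
  shows "commutator G (inv a) x = inv a \<otimes> inv (commutator G a x) \<otimes> inv (inv a)"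
  using assms by (simp add: m_assoc inv_mult_group inv_cancel_left)

lemma commutator_conjugate:
  assumes "g \<in> carrier G" "x \<in> carrier G" "y \<in> carrier G"
  shows "g \<otimes> commutator G x y \<otimes> inv g
       = commutator G (g \<otimes> x \<otimes> inv g) (g \<otimes> y \<otimes> inv g)"
  using assms by (simp add: m_assoc inv_mult_group inv_cancel_left)

lemma commutator_in_normal_left:
  assumes "M \<lhd> G" "x \<in> M" "y \<in> carrier G"
  shows "commutator G x y \<in> M"
proof -
  interpret normal M G by fact
  have "commutator G x y = x \<otimes> (y \<otimes> inv x \<otimes> inv y)"
    using assms mem_carrier by (simp add: m_assoc)
  then show ?thesis
    using assms inv_op_closed2 by simp
qed

lemma commutator_in_normal_right:
  assumes "M \<lhd> G" "x \<in> carrier G" "y \<in> M"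
  shows "commutator G x y \<in> M"
proof -
  interpret normal M G by fact
  show ?thesis
    using assms inv_op_closed2 by simp
qed

text \<open>This set is the preimage of the centralizer of the image of \<open>T\<close> in the quotient by \<open>M\<close>.\<close>

lemma subgroup_centralizer_mod_normal:
  assumes "M \<lhd> G" "T \<subseteq> carrier G"
  shows "subgroup {a \<in> carrier G. \<forall>x\<in>T. commutator G a x \<in> M} G" (is "subgroup ?C G")
proof (rule subgroupI)
  interpret normal M G by fact
  show "?C \<subseteq> carrier G" by auto
  have "\<one> \<in> ?C"
    using assms(2) by (auto simp: subset_iff)
  then show "?C \<noteq> {}" by blast
  show "inv a \<in> ?C" if "a \<in> ?C" for a
  proof -
    have a: "a \<in> carrier G" using that by simp
    have "commutator G (inv a) x \<in> M" if x: "x \<in> T" for x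
    proof -
      have "inv (commutator G a x) \<in> M"
        using \<open>a \<in> ?C\<close> x by (blast intro: m_inv_closed)
      then have "inv a \<otimes> inv (commutator G a x) \<otimes> inv (inv a) \<in> M"
        using a by (intro inv_op_closed2) auto
      then show ?thesis
        using a x assms(2) commutator_inv_left[of a x] by auto
    qed
    then show ?thesis using a by simp
  qed
  show "a \<otimes> b \<in> ?C" if "a \<in> ?C" "b \<in> ?C" for a b
  proof -
    have ab: "a \<in> carrier G" "b \<in> carrier G" using that by simp_all
    have "commutator G (a \<otimes> b) x \<in> M" if x: "x \<in> T" for x
    proof -
      have "commutator G a x \<in> M" "commutator G b x \<in> M"
        using \<open>a \<in> ?C\<close> \<open>b \<in> ?C\<close> x by simp_all
      then have "a \<otimes> commutator G b x \<otimes> inv a \<otimes> commutator G a x \<in> M"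
        using ab by (blast intro: m_closed[OF inv_op_closed2])
      then show ?thesis
        using ab x assms(2) commutator_mult_left[of a b x] by auto
    qed
    then show ?thesis using ab by simp
  qed
qed

lemma commutator_generate_left_in_normal:
  assumes "M \<lhd> G" "A \<subseteq> carrier G" "T \<subseteq> carrier G"
    and "\<And>a x. a \<in> A \<Longrightarrow> x \<in> T \<Longrightarrow> commutator G a x \<in> M"
    and "a \<in> generate G A" "x \<in> T"
  shows "commutator G a x \<in> M"
proof -
  have "generate G A \<subseteq> {a \<in> carrier G. \<forall>x\<in>T. commutator G a x \<in> M}"
    using assms by (intro generate_subgroup_incl subgroup_centralizer_mod_normal) auto
  then show ?thesis using assms by blast
qed

lemma commutator_swap_in_normal:
  assumes "M \<lhd> G" "x \<in> carrier G" "y \<in> carrier G" "commutator G x y \<in> M"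
  shows "commutator G y x \<in> M"
  using assms inv_commutator normal_imp_subgroup subgroup.m_inv_closed by metis

text \<open>Modulo \<open>M\<close>, commuting generators generate commuting subgroups: the centralizer argument
  extends the hypothesis to \<open>\<langle>A\<rangle>\<close>, then, with the two sides exchanged, to \<open>\<langle>T\<rangle>\<close>.\<close>

lemma commutator_generate_in_normal:
  assumes M: "M \<lhd> G" and A: "A \<subseteq> carrier G" and T: "T \<subseteq> carrier G"
    and AT: "\<And>a x. a \<in> A \<Longrightarrow> x \<in> T \<Longrightarrow> commutator G a x \<in> M"
    and a: "a \<in> generate G A" and x: "x \<in> generate G T"
  shows "commutator G a x \<in> M"
proof -
  have carr: "generate G A \<subseteq> carrier G" "generate G T \<subseteq> carrier G"
    using A T generate_incl by simp_all
  have "commutator G y b \<in> M" if y: "y \<in> T" and b: "b \<in> generate G A" for y b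
  proof (rule commutator_swap_in_normal[OF M])
    show "commutator G b y \<in> M"
      using M A T AT b y by (rule commutator_generate_left_in_normal)
  qed (use y b T carr in blast)+
  then have "commutator G x a \<in> M"
    using commutator_generate_left_in_normal[OF M T carr(1) _ x a] by blast
  then show ?thesis
    using a x carr commutator_swap_in_normal[OF M, of x a] by blast
qed

lemma commutator_subgroup_incl:
  assumes "subgroup M G" "\<And>x y. x \<in> T \<Longrightarrow> y \<in> Y \<Longrightarrow> commutator G x y \<in> M"
  shows "commutator_subgroup G T Y \<subseteq> M"
  unfolding commutator_subgroup_def using assms by (intro generate_subgroup_incl) auto

lemma commutator_in_commutator_subgroup:
  assumes "x \<in> T" "y \<in> Y"
  shows "commutator G x y \<in> commutator_subgroup G T Y"
  unfolding commutator_subgroup_def using assms by (intro generate.incl) auto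

lemma commutator_subgroup_is_subgroup:
  assumes "T \<subseteq> carrier G" "Y \<subseteq> carrier G"
  shows "subgroup (commutator_subgroup G T Y) G"
  unfolding commutator_subgroup_def using assms by (intro generate_is_subgroup) (auto simp: subset_iff)

lemma commutator_subgroup_normal:
  assumes T: "T \<lhd> G" and Y: "Y \<lhd> G"
  shows "commutator_subgroup G T Y \<lhd> G"
  unfolding commutator_subgroup_def
proof (rule normal_generateI)
  interpret T: normal T G by fact
  interpret Y: normal Y G by fact
  show "(\<Union>x\<in>T. \<Union>y\<in>Y. {commutator G x y}) \<subseteq> carrier G"
    using T.subset Y.subset by auto
  fix c g assume c: "c \<in> (\<Union>x\<in>T. \<Union>y\<in>Y. {commutator G x y})" and g: "g \<in> carrier G"
  then obtain x y where xy: "x \<in> T" "y \<in> Y" "c = commutator G x y" by auto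
  have "g \<otimes> c \<otimes> inv g = commutator G (g \<otimes> x \<otimes> inv g) (g \<otimes> y \<otimes> inv g)"
    using xy g by (simp add: commutator_conjugate)
  moreover have "g \<otimes> x \<otimes> inv g \<in> T" "g \<otimes> y \<otimes> inv g \<in> Y"
    using xy g T.inv_op_closed2 Y.inv_op_closed2 by auto
  ultimately show "g \<otimes> c \<otimes> inv g \<in> (\<Union>x\<in>T. \<Union>y\<in>Y. {commutator G x y})"
    by blast
qed

section \<open>Central chains and nilpotent subgroups\<close>

lemma commutator_subgroup_restrict:
  assumes H: "subgroup H G" and "T \<subseteq> H" "Y \<subseteq> H"
  shows "commutator_subgroup (G\<lparr>carrier := H\<rparr>) T Y = commutator_subgroup G T Y"
proof -
  interpret subgroup H G by fact
  have eq: "(\<Union>x\<in>T. \<Union>y\<in>Y. {commutator (G\<lparr>carrier := H\<rparr>) x y})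
      = (\<Union>x\<in>T. \<Union>y\<in>Y. {commutator G x y})"
    using assms(2,3) by (intro SUP_cong refl) (simp add: m_inv_consistent[OF H] subset_iff)
  have "(\<Union>x\<in>T. \<Union>y\<in>Y. {commutator G x y}) \<subseteq> H"
    using assms(2,3) by (auto simp: subset_iff)
  then show ?thesis
    unfolding commutator_subgroup_def eq by (rule generate_consistent[OF _ H])
qed

lemma lower_central_series_subgroup:
  assumes H: "subgroup H G"
  shows "subgroup (lower_central_series (G\<lparr>carrier := H\<rparr>) n) G
       \<and> lower_central_series (G\<lparr>carrier := H\<rparr>) n \<subseteq> H"
proof (induction n)
  case 0
  show ?case using H by simp
next
  case (Suc n)
  interpret subgroup H G by fact
  let ?L = "lower_central_series (G\<lparr>carrier := H\<rparr>) n"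
  have "commutator_subgroup G ?L H \<subseteq> H"
    using Suc by (intro commutator_subgroup_incl[OF H]) (auto simp: subset_iff)
  moreover have "subgroup (commutator_subgroup G ?L H) G"
    using Suc subset by (intro commutator_subgroup_is_subgroup) auto
  ultimately show ?case
    using Suc by (simp add: commutator_subgroup_restrict[OF H])
qed

lemma lower_central_series_restrict_Suc:
  assumes "subgroup H G"
  shows "lower_central_series (G\<lparr>carrier := H\<rparr>) (Suc n)
       = commutator_subgroup G (lower_central_series (G\<lparr>carrier := H\<rparr>) n) H"
  using assms lower_central_series_subgroup by (simp add: commutator_subgroup_restrict)

lemma lower_central_series_normal:
  assumes "H \<lhd> G"
  shows "lower_central_series (G\<lparr>carrier := H\<rparr>) n \<lhd> G"
proof (induction n)
  case 0
  show ?case using assms by simp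
next
  case (Suc n)
  then show ?case
    using assms lower_central_series_restrict_Suc[OF normal_imp_subgroup[OF assms]]
    by (simp add: commutator_subgroup_normal)
qed

lemma lower_central_series_stays_trivial:
  assumes H: "subgroup H G" and "lower_central_series (G\<lparr>carrier := H\<rparr>) m = {\<one>}" and "m \<le> n"
  shows "lower_central_series (G\<lparr>carrier := H\<rparr>) n = {\<one>}"
  using \<open>m \<le> n\<close>
proof (induction n rule: dec_induct)
  case base
  show ?case by fact
next
  case (step n)
  interpret subgroup H G by fact
  have "commutator_subgroup G {\<one>} H \<subseteq> {\<one>}"
    using subset by (intro commutator_subgroup_incl triv_subgroup) (auto simp: subset_iff)
  then have "lower_central_series (G\<lparr>carrier := H\<rparr>) (Suc n) \<subseteq> {\<one>}"
    unfolding lower_central_series_restrict_Suc[OF H] step.IH .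
  then show ?case
    using lower_central_series_subgroup[OF H, of "Suc n"] subgroup.one_closed by blast
qed

text \<open>The lower central series is the fastest descending central chain, so any chain on which
  commutation with \<open>H\<close> moves one step down bounds it term by term. The terms need not be contained
  in \<open>H\<close>; Fitting's theorem uses this freedom with \<open>Z 0\<close> the whole group.\<close>

lemma nilpotent_subgroup_if_central_chain:
  assumes H: "subgroup H G" and Z: "\<And>n. subgroup (Z n) G" and "H \<subseteq> Z 0"
    and step: "\<And>n z h. z \<in> Z n \<Longrightarrow> h \<in> H \<Longrightarrow> commutator G z h \<in> Z (Suc n)"
    and triv: "Z c \<subseteq> {\<one>}"
  shows "nilpotent_subgroup H G"
proof -
  have incl: "lower_central_series (G\<lparr>carrier := H\<rparr>) n \<subseteq> Z n" for n
  proof (induction n)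
    case 0
    show ?case using \<open>H \<subseteq> Z 0\<close> by simp
  next
    case (Suc n)
    then show ?case
      unfolding lower_central_series_restrict_Suc[OF H]
      by (intro commutator_subgroup_incl Z step) auto
  qed
  have "\<one> \<in> lower_central_series (G\<lparr>carrier := H\<rparr>) c"
    using lower_central_series_subgroup[OF H] subgroup.one_closed by blast
  then have "lower_central_series (G\<lparr>carrier := H\<rparr>) c = {\<one>}"
    using incl[of c] triv by blast
  then show ?thesis
    unfolding nilpotent_subgroup_def nilpotent_group_def
    using H subgroup_imp_group by auto
qed

lemma nilpotent_subgroup_trivial: "nilpotent_subgroup {\<one>} G"
  by (rule nilpotent_subgroup_if_central_chain[of _ "\<lambda>_. {\<one>}"]) (auto simp: triv_subgroup)

lemma nilpotent_subgroup_mono: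
  assumes "nilpotent_subgroup U G" "subgroup V G" "V \<subseteq> U"
  shows "nilpotent_subgroup V G"
proof -
  let ?L = "lower_central_series (G\<lparr>carrier := U\<rparr>)"
  have U: "subgroup U G" using assms(1) by (simp add: nilpotent_subgroup_def)
  obtain c where c: "?L c = {\<one>}"
    using assms(1) by (auto simp: nilpotent_subgroup_def nilpotent_group_def)
  show ?thesis
  proof (rule nilpotent_subgroup_if_central_chain[where Z = ?L and c = c])
    show "subgroup (?L n) G" for n
      using lower_central_series_subgroup[OF U] by simp
    show "commutator G z h \<in> ?L (Suc n)" if "z \<in> ?L n" "h \<in> V" for n z h
      unfolding lower_central_series_restrict_Suc[OF U]
      using that assms(3) by (intro commutator_in_commutator_subgroup) auto
  qed (use assms c in auto)
qed

section \<open>Fitting's theorem\<close>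

text \<open>The chain is the lower central series of \<open>H\<close> with \<open>G\<close> put in front; normality of \<open>H\<close>
  gives the added step \<open>[G, H] \<subseteq> H\<close> and makes all terms normal in \<open>G\<close>.\<close>

lemma normal_nilpotent_central_chain:
  assumes H: "H \<lhd> G" and nilp: "nilpotent_subgroup H G"
  obtains A m where "A 0 = carrier G" "\<And>i. A i \<lhd> G"
    "\<And>i a h. a \<in> A i \<Longrightarrow> h \<in> H \<Longrightarrow> commutator G a h \<in> A (Suc i)"
    "\<And>i. m \<le> i \<Longrightarrow> A i = {\<one>}"
proof -
  let ?L = "lower_central_series (G\<lparr>carrier := H\<rparr>)"
  define A where "A = case_nat (carrier G) ?L"
  have sub: "subgroup H G" using H by (rule normal_imp_subgroup)
  obtain c where c: "?L c = {\<one>}"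
    using nilp by (auto simp: nilpotent_subgroup_def nilpotent_group_def)
  show thesis
  proof (rule that[of A "Suc c"])
    show "A 0 = carrier G" by (simp add: A_def)
    have "carrier G \<lhd> G"
      by (rule normal_invI[OF subgroup_self]) auto
    then show "A i \<lhd> G" for i
      using lower_central_series_normal[OF H] by (cases i) (simp_all add: A_def)
    show "commutator G a h \<in> A (Suc i)" if "a \<in> A i" "h \<in> H" for i a h
    proof (cases i)
      case 0
      then show ?thesis
        using that commutator_in_normal_right[OF H] by (simp add: A_def)
    next
      case (Suc j)
      then show ?thesis
        using that lower_central_series_restrict_Suc[OF sub, of j]
        by (simp add: A_def commutator_in_commutator_subgroup)
    qed
    show "A i = {\<one>}" if "Suc c \<le> i" for i
      using that lower_central_series_stays_trivial[OF sub c]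
      by (cases i) (simp_all add: A_def)
  qed
qed

theorem nilpotent_subgroup_join_normal:
  assumes H: "H \<lhd> G" "nilpotent_subgroup H G" and K: "K \<lhd> G" "nilpotent_subgroup K G"
  shows "nilpotent_subgroup (generate G (H \<union> K)) G"
proof -
  obtain A m where A0: "A 0 = carrier G" and An: "\<And>i. A i \<lhd> G"
    and As: "\<And>i a h. a \<in> A i \<Longrightarrow> h \<in> H \<Longrightarrow> commutator G a h \<in> A (Suc i)"
    and At: "\<And>i. m \<le> i \<Longrightarrow> A i = {\<one>}"
    using H by (rule normal_nilpotent_central_chain) blast
  obtain B n where B0: "B 0 = carrier G" and Bn: "\<And>i. B i \<lhd> G"
    and Bs: "\<And>i b k. b \<in> B i \<Longrightarrow> k \<in> K \<Longrightarrow> commutator G b k \<in> B (Suc i)"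
    and Bt: "\<And>i. n \<le> i \<Longrightarrow> B i = {\<one>}"
    using K by (rule normal_nilpotent_central_chain) blast
  define S where "S p = (\<Union>i\<le>p. A i \<inter> B (p - i))" for p
  define W where "W p = generate G (S p)" for p
  have HK: "H \<union> K \<subseteq> carrier G"
    using H(1) K(1) normal_imp_subgroup subgroup.subset by blast
  have AB: "A i \<inter> B j \<lhd> G" for i j
    by (intro normal_subgroup_intersect An Bn)
  have S: "S p \<subseteq> carrier G" for p
    unfolding S_def using AB normal_imp_subgroup subgroup.subset by blast
  have Wn: "W p \<lhd> G" for p
    unfolding W_def
  proof (rule normal_generateI[OF S])
    fix s g assume "s \<in> S p" and g: "g \<in> carrier G"
    then obtain i where i: "i \<le> p" "s \<in> A i \<inter> B (p - i)" by (auto simp: S_def)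
    then have "g \<otimes> s \<otimes> inv g \<in> A i \<inter> B (p - i)"
      using g by (intro normal.inv_op_closed2[OF AB])
    then show "g \<otimes> s \<otimes> inv g \<in> S p" using i by (auto simp: S_def)
  qed
  have gen: "commutator G s x \<in> W (Suc p)" if "s \<in> S p" "x \<in> H \<union> K" for s x p
  proof -
    obtain i where i: "i \<le> p" "s \<in> A i" "s \<in> B (p - i)"
      using \<open>s \<in> S p\<close> by (auto simp: S_def)
    have x: "x \<in> carrier G" using that HK by blast
    have "\<exists>j\<le>Suc p. commutator G s x \<in> A j \<inter> B (Suc p - j)"
    proof (cases "x \<in> H")
      case True
      then have "commutator G s x \<in> A (Suc i) \<inter> B (p - i)"
        using i x As commutator_in_normal_left[OF Bn] by blast
      then show ?thesis
        using i by (intro exI[of _ "Suc i"]) simp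
    next
      case False
      then have "commutator G s x \<in> A i \<inter> B (Suc (p - i))"
        using that i x Bs commutator_in_normal_left[OF An] by blast
      then show ?thesis
        using i by (intro exI[of _ i]) (simp add: Suc_diff_le)
    qed
    then show ?thesis
      unfolding W_def S_def by (intro generate.incl) blast
  qed
  show ?thesis
  proof (rule nilpotent_subgroup_if_central_chain[where Z = W and c = "m + n"])
    show "subgroup (generate G (H \<union> K)) G"
      using HK by (rule generate_is_subgroup)
    show "subgroup (W p) G" for p
      using Wn by (rule normal_imp_subgroup)
    have "S 0 = carrier G" by (simp add: S_def A0 B0)
    then have "carrier G \<subseteq> W 0"
      unfolding W_def by (simp add: generate.incl subsetI)
    then show "generate G (H \<union> K) \<subseteq> W 0"
      by (rule subset_trans[OF generate_incl[OF HK]])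
    show "commutator G w x \<in> W (Suc p)" if "w \<in> W p" "x \<in> generate G (H \<union> K)" for p w x
      using commutator_generate_in_normal[OF Wn S HK gen] that by (simp add: W_def)
    have "A i \<inter> B (m + n - i) \<subseteq> {\<one>}" for i
    proof (cases "m \<le> i")
      case False
      \<comment> \<open>the two indices add up to \<open>m + n\<close>, so a small first one forces a large second one\<close>
      then have "n \<le> m + n - i" by simp
      then show ?thesis using Bt by blast
    qed (use At in blast)
    then have "S (m + n) \<subseteq> {\<one>}"
      unfolding S_def by blast
    then show "W (m + n) \<subseteq> {\<one>}"
      unfolding W_def by (rule generate_subgroup_incl[OF _ triv_subgroup])
  qed
qed

lemma generate_Un_normal:
  assumes "H \<lhd> G" "K \<lhd> G"
  shows "generate G (H \<union> K) \<lhd> G"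
proof (rule normal_generateI)
  interpret H: normal H G by fact
  interpret K: normal K G by fact
  show "H \<union> K \<subseteq> carrier G"
    using H.subset K.subset by simp
  show "g \<otimes> x \<otimes> inv g \<in> H \<union> K" if "x \<in> H \<union> K" "g \<in> carrier G" for x g
    using that H.inv_op_closed2 K.inv_op_closed2 by auto
qed

text \<open>A normal nilpotent subgroup \<open>N\<close> of maximal order is the greatest one: for any other \<open>M\<close>,
  maximality applied to \<open>\<langle>N \<union> M\<rangle>\<close> gives \<open>\<langle>N \<union> M\<rangle> = N\<close>.\<close>

lemma fitting_subgroup_normal_nilpotent:
  assumes fin: "finite (carrier G)"
  shows "fitting_subgroup G \<lhd> G \<and> nilpotent_subgroup (fitting_subgroup G) G"
proof -
  let ?P = "\<lambda>N. N \<lhd> G \<and> nilpotent_subgroup N G"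
  have sub: "N \<subseteq> carrier G" if "?P N" for N
    using that by (simp add: normal_imp_subgroup subgroup.subset)
  have "?P {\<one>}"
    using one_is_normal nilpotent_subgroup_trivial by simp
  moreover have "\<forall>N. ?P N \<longrightarrow> card N < Suc (card (carrier G))"
    using sub fin by (simp add: card_mono le_imp_less_Suc)
  ultimately obtain N where N: "?P N" and max: "\<And>M. ?P M \<Longrightarrow> card M \<le> card N"
    using ex_has_greatest_nat[of ?P "{\<one>}" card] by blast
  have "M \<subseteq> N" if M: "?P M" for M
  proof -
    let ?J = "generate G (N \<union> M)"
    have J: "?P ?J"
      using N M generate_Un_normal nilpotent_subgroup_join_normal by simp
    have incl: "N \<union> M \<subseteq> ?J"
      by (simp add: generate.incl subset_iff)
    have "N = ?J"
      using incl max[OF J] finite_subset[OF sub[OF J] fin] by (intro card_seteq) auto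
    then show ?thesis using incl by blast
  qed
  then have "fitting_subgroup G = N"
    unfolding fitting_subgroup_def using N by (intro Greatest_equality) auto
  then show ?thesis using N by simp
qed

section \<open>Cliques of the nilpotent graph\<close>

lemma nilpotent_subgroup_is_clique:
  assumes U: "nilpotent_subgroup U G" and "\<not> U \<subseteq> nil_set G"
  shows "is_clique (nilpotent_graph G) (U - (U \<inter> nil_set G))"
proof -
  have sub: "subgroup U G" using U by (simp add: nilpotent_subgroup_def)
  then have carr: "U \<subseteq> carrier G" by (rule subgroup.subset)
  have "{g, h} \<in> snd (nilpotent_graph G)"
    if g: "g \<in> U - nil_set G" and h: "h \<in> U - nil_set G" and "g \<noteq> h" for g h
  proof -
    have "generate G {g, h} \<subseteq> U"
      using g h by (intro generate_subgroup_incl[OF _ sub]) simp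
    moreover have "subgroup (generate G {g, h}) G"
      using g h carr by (intro generate_is_subgroup) auto
    ultimately have "nilpotent_subgroup (generate G {g, h}) G"
      using nilpotent_subgroup_mono[OF U] by simp
    moreover have "g \<in> carrier G - nil_set G" "h \<in> carrier G - nil_set G"
      using g h carr by auto
    ultimately show ?thesis
      unfolding nilpotent_graph_def snd_conv using \<open>g \<noteq> h\<close> by blast
  qed
  then have "clique (U - (U \<inter> nil_set G)) (snd (nilpotent_graph G))"
    by (simp add: clique_def)
  then show ?thesis
    using assms(2) carr by (auto simp: is_clique_def nilpotent_graph_def)
qed

end

lemma card_clique_le_clique_number:
  assumes "finite (fst \<Gamma>)" "is_clique \<Gamma> C"
  shows "card C \<le> clique_number \<Gamma>"
proof -
  have "{card C | C. is_clique \<Gamma> C} \<subseteq> card ` Pow (fst \<Gamma>)"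
    by (auto simp: is_clique_def)
  then have "finite {card C | C. is_clique \<Gamma> C}"
    using assms(1) by (meson finite_Pow_iff finite_imageI finite_subset)
  then show ?thesis
    unfolding clique_number_def using assms(2) by (intro Max_ge) auto
qed

lemma (in group) card_nilpotent_subgroup_le_clique_number:
  assumes "finite (carrier G)" "nilpotent_subgroup U G"
  shows "card (U - (U \<inter> nil_set G)) \<le> clique_number (nilpotent_graph G)"
proof (cases "U \<subseteq> nil_set G")
  case True
  then have "U - (U \<inter> nil_set G) = {}" by blast
  then show ?thesis by (simp only: card.empty le0)
next
  case False
  then show ?thesis
    using assms nilpotent_subgroup_is_clique
    by (intro card_clique_le_clique_number) (simp_all add: nilpotent_graph_def)
qed

theorem lemma3p1:
  fixes G :: "('a, 'b) monoid_scheme"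
  assumes "group G" and "finite (carrier G)" and "\<not> nilpotent_group G"
  shows "(\<forall>U. nilpotent_subgroup U G \<and> \<not> U \<subseteq> nil_set G \<longrightarrow>
              is_clique (nilpotent_graph G) (U - (U \<inter> nil_set G))) \<and>
         (\<forall>N. N \<lhd> G \<and> nilpotent_subgroup N G \<longrightarrow>
              card (N - (N \<inter> nil_set G)) \<le> clique_number (nilpotent_graph G)) \<and>
         card (fitting_subgroup G - (fitting_subgroup G \<inter> nil_set G))
           \<le> clique_number (nilpotent_graph G)"
proof -
  interpret group G by fact
  show ?thesis
    using nilpotent_subgroup_is_clique card_nilpotent_subgroup_le_clique_number[OF assms(2)]
      fitting_subgroup_normal_nilpotent[OF assms(2)]
    by blast
qed

end
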